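(* Let $A$ be a finite-dimensional real associative algebra with unit, endowed with a positive definite inner product $\langle\cdot,\cdot\rangle$ normalized by $\langle1,1\rangle=1$. Let $S=\{a\in A:a^2=-1\}$ and $$S_0=\{s\in S:\ L_sL_s^t=I\}.$$ Then $S_0$ is a compact complex subvariety of $S$ with respect to the complex structure $J_S$.
   Context: $L_a(x)=ax$ is left multiplication on $A$ and $L_a^t$ its adjoint with respect to $\langle\cdot,\cdot\rangle$. No compatibility between the inner product and the product of $A$ is assumed. $S$ is a smooth embedded submanifold of $A$ with $T_sS=\{h\in A:sh+hs=0\}$, and $J_S(h)=sh$ for $h\in T_sS$ is an integrable complex structure on it. "Complex subvariety" means closed complex analytic subset. *)

theory Defs
  imports "HOL-Analysis.Analysis"
begin

text \<open>
  The algebra \<open>A\<close> is a type of sort \<open>{real_algebra_1, euclidean_space}\<close>: a unital associative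
  real algebra which, as a vector space, is finite dimensional and carries a positive definite
  inner product. The two classes share only the vector space structure, so the inner product
  (and its norm) need not be compatible with the multiplication.
\<close>

definition imag_units :: "'a::{real_algebra_1,euclidean_space} set" where
  "imag_units = {a. a ^ 2 = - 1}"

definition orth_imag_units :: "'a::{real_algebra_1,euclidean_space} set" where
  "orth_imag_units = {s \<in> imag_units. (\<lambda>x. s * x) \<circ> adjoint (\<lambda>x. s * x) = id}"

definition tangent_imag_units :: "'a::{real_algebra_1,euclidean_space} \<Rightarrow> 'a set" where
  "tangent_imag_units s = {h. s * h + h * s = 0}"

definition J_imag_units :: "'a::{real_algebra_1,euclidean_space} \<Rightarrow> 'a \<Rightarrow> 'a" where
  "J_imag_units s h = s * h"

primrec Ck_on :: "nat \<Rightarrow> 'a::real_normed_vector set \<Rightarrow> ('a \<Rightarrow> 'b::real_normed_vector) \<Rightarrow> bool" where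
  "Ck_on 0 V f \<longleftrightarrow> continuous_on V f"
| "Ck_on (Suc k) V f \<longleftrightarrow> (\<forall>x\<in>V. f differentiable (at x)) \<and>
     (\<forall>v. Ck_on k V (\<lambda>x. frechet_derivative f (at x) v))"

text \<open>\<open>C\<^sup>\<infinity>\<close> functions, used for open \<open>V\<close> only.\<close>

definition smooth_on :: "'a::real_normed_vector set \<Rightarrow> ('a \<Rightarrow> 'b::real_normed_vector) \<Rightarrow> bool" where
  "smooth_on V f \<longleftrightarrow> (\<forall>k. Ck_on k V f)"

text \<open>
  Functions on a relatively open subset \<open>W\<close> of the embedded submanifold \<open>imag_units\<close> that are
  holomorphic for \<open>J_imag_units\<close>: near every point \<open>f\<close> is the restriction of an ambient smooth
  function \<open>F\<close>, and the intrinsic differential \<open>df\<^sub>s\<close>, i.e. the restriction of \<open>dF\<^sub>s\<close> to the tangent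
  space, satisfies the Cauchy-Riemann equation \<open>df\<^sub>s \<circ> J = \<i> df\<^sub>s\<close>. The values of \<open>f\<close> outside \<open>W\<close>
  are irrelevant.
\<close>

definition holomorphic_on_imag_units ::
    "'a::{real_algebra_1,euclidean_space} set \<Rightarrow> ('a \<Rightarrow> complex) \<Rightarrow> bool" where
  "holomorphic_on_imag_units W f \<longleftrightarrow>
     (\<forall>s\<in>W. \<exists>V F. open V \<and> s \<in> V \<and> smooth_on V F \<and> (\<forall>x\<in>V \<inter> W. F x = f x) \<and>
        (\<forall>h\<in>tangent_imag_units s.
           frechet_derivative F (at s) (J_imag_units s h) = \<i> * frechet_derivative F (at s) h))"

definition complex_subvariety_imag_units :: "'a::{real_algebra_1,euclidean_space} set \<Rightarrow> bool" where
  "complex_subvariety_imag_units Z \<longleftrightarrow>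
     closedin (top_of_set imag_units) Z \<and>
     (\<forall>p\<in>imag_units. \<exists>W \<F>. openin (top_of_set imag_units) W \<and> p \<in> W \<and>
        finite \<F> \<and> (\<forall>f\<in>\<F>. holomorphic_on_imag_units W f) \<and>
        Z \<inter> W = {x \<in> W. \<forall>f\<in>\<F>. f x = 0})"

end

theory Submission
  imports Defs
begin

text \<open>
  For \<open>s \<in> S\<close> orthogonality of left multiplication by \<open>s\<close> means skew-adjointness. Hence
  \<open>S\<^sub>0\<close> is closed and all its elements have the norm of \<open>1\<close>, so it is compact. Near a point
  outside \<open>S\<^sub>0\<close> the constant function \<open>1\<close> is a local equation. Near \<open>p \<in> S\<^sub>0\<close> use the Cayley
  chart \<open>w(s) = (s + p)\<inverse>(s - p)\<close>. It takes values in the vectors anticommuting with \<open>p\<close>,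
  satisfies \<open>s(1 - w) = (1 - w)p\<close>, and is holomorphic since \<open>dw(sh) = p dw(h)\<close>. Transporting
  skew-adjointness of \<open>s\<close> along \<open>1 - w\<close>, the terms of order zero and two in \<open>w\<close> cancel because
  \<open>p\<close> is skew-adjoint, and what remains is skew-adjointness of \<open>pw\<close>. This real linear condition
  on \<open>w\<close> is invariant under \<open>w \<mapsto> pw\<close>, hence complex linear.
\<close>

section \<open>Smooth functions\<close>

text \<open>Derivatives at points of the open set \<open>V\<close> see only values in
  \<open>V\<close>, so agreement on \<open>V\<close> passes to directional derivatives and the
  induction goes through.\<close>

lemma Ck_on_cong:
  assumes "open V" "\<And>x. x \<in> V \<Longrightarrow> f x = g x" "Ck_on k V f"
  shows "Ck_on k V g"
  using assms(2,3)
proof (induction k arbitrary: f g)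
  case 0
  then show ?case using continuous_on_cong by force
next
  case (Suc k)
  have D: "(g has_derivative frechet_derivative f (at x)) (at x)" if "x \<in> V" for x
  proof -
    have "(f has_derivative frechet_derivative f (at x)) (at x)"
      using Suc.prems(2) that frechet_derivative_works by auto
    then show ?thesis
      by (rule has_derivative_transform_within_open[OF _ assms(1) that Suc.prems(1)])
  qed
  then have "frechet_derivative f (at x) = frechet_derivative g (at x)" if "x \<in> V" for x
    using frechet_derivative_at that by blast
  then have "Ck_on k V (\<lambda>x. frechet_derivative g (at x) v)" for v
    using Suc.IH[of "\<lambda>x. frechet_derivative f (at x) v"] Suc.prems(2) by simp
  moreover have "g differentiable (at x)" if "x \<in> V" for x
    using D that differentiable_def by blast
  ultimately show ?case by simp
qed

text \<open>Allows an explicit derivative formula in place of \<open>frechet_derivative\<close>; the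
  closure properties below are proved through it.\<close>

lemma Ck_on_SucI:
  assumes "open V" "\<And>x. x \<in> V \<Longrightarrow> (f has_derivative f' x) (at x)"
    and "\<And>v. Ck_on k V (\<lambda>x. f' x v)"
  shows "Ck_on (Suc k) V f"
proof -
  have "f' x = frechet_derivative f (at x)" if "x \<in> V" for x
    using frechet_derivative_at assms(2) that by blast
  then have "Ck_on k V (\<lambda>x. frechet_derivative f (at x) v)" for v
    using Ck_on_cong[OF assms(1) _ assms(3)] by simp
  moreover have "f differentiable (at x)" if "x \<in> V" for x
    using assms(2) that differentiable_def by blast
  ultimately show ?thesis by simp
qed

lemma Ck_on_Suc_imp: "Ck_on (Suc k) V f \<Longrightarrow> Ck_on k V f"
proof (induction k arbitrary: f)
  case 0
  then have "continuous (at x) f" if "x \<in> V" for x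
    using that differentiable_imp_continuous_within by auto
  then show ?case by (simp add: continuous_at_imp_continuous_on)
qed auto

lemma has_derivative_Ck_on:
  assumes "Ck_on (Suc k) V f" "x \<in> V"
  shows "(f has_derivative frechet_derivative f (at x)) (at x)"
  using assms frechet_derivative_works by auto

lemma Ck_on_const: "open V \<Longrightarrow> Ck_on k V (\<lambda>_. c)"
proof (induction k arbitrary: c)
  case (Suc k)
  then show ?case by (intro Ck_on_SucI[where f' = "\<lambda>_ _. 0"]) auto
qed simp

lemma Ck_on_add:
  assumes "open V" "Ck_on k V f" "Ck_on k V g"
  shows "Ck_on k V (\<lambda>x. f x + g x)"
  using assms(2,3)
proof (induction k arbitrary: f g)
  case 0
  then show ?case by (auto intro: continuous_on_add)
next
  case (Suc k)
  show ?case
  proof (rule Ck_on_SucI[OF assms(1)])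
    show "((\<lambda>x. f x + g x) has_derivative
        (\<lambda>v. frechet_derivative f (at x) v + frechet_derivative g (at x) v)) (at x)"
      if "x \<in> V" for x
      using Suc.prems that by (intro has_derivative_add has_derivative_Ck_on)
    show "Ck_on k V (\<lambda>x. frechet_derivative f (at x) v + frechet_derivative g (at x) v)" for v
      using Suc by simp
  qed
qed

lemma Ck_on_bilinear:
  assumes B: "bounded_bilinear B" and "open V" "Ck_on k V f" "Ck_on k V g"
  shows "Ck_on k V (\<lambda>x. B (f x) (g x))"
  using assms(3,4)
proof (induction k arbitrary: f g)
  case 0
  then show ?case by (auto intro: bounded_bilinear.continuous_on[OF B])
next
  case (Suc k)
  show ?case
  proof (rule Ck_on_SucI[OF assms(2)])
    show "((\<lambda>x. B (f x) (g x)) has_derivative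
        (\<lambda>v. B (f x) (frechet_derivative g (at x) v) +
              B (frechet_derivative f (at x) v) (g x))) (at x)"
      if "x \<in> V" for x
      using Suc.prems that by (intro bounded_bilinear.FDERIV[OF B] has_derivative_Ck_on)
    show "Ck_on k V (\<lambda>x. B (f x) (frechet_derivative g (at x) v) +
              B (frechet_derivative f (at x) v) (g x))" for v
      \<comment> \<open>In each summand of the Leibniz rule one factor stays undifferentiated;
        \<open>Ck_on_Suc_imp\<close> lowers that factor to order \<open>k\<close>.\<close>
      using Suc.prems by (intro Ck_on_add assms(2) Suc.IH) (auto dest: Ck_on_Suc_imp simp del: Ck_on.simps(2), auto)
  qed
qed

lemma Ck_on_id: "open V \<Longrightarrow> Ck_on k V (\<lambda>x. x)"
proof (cases k)
  case (Suc m)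
  assume "open V"
  then show ?thesis unfolding Suc
    by (rule Ck_on_SucI[where f' = "\<lambda>_ v. v"]) (auto intro: Ck_on_const \<open>open V\<close>)
qed simp

lemma Ck_on_linear:
  assumes "bounded_linear L" "open V" "Ck_on k V f"
  shows "Ck_on k V (\<lambda>x. L (f x))"
  using assms(3)
proof (induction k arbitrary: f)
  case 0
  then show ?case using assms(1) by (auto intro: bounded_linear.continuous_on)
next
  case (Suc k)
  show ?case
  proof (rule Ck_on_SucI[OF assms(2)])
    show "((\<lambda>x. L (f x)) has_derivative (\<lambda>v. L (frechet_derivative f (at x) v))) (at x)"
      if "x \<in> V" for x
      using Suc.prems that by (intro bounded_linear.has_derivative[OF assms(1)] has_derivative_Ck_on)
    show "Ck_on k V (\<lambda>x. L (frechet_derivative f (at x) v))" for v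
      using Suc by simp
  qed
qed

section \<open>Inversion in a finite-dimensional algebra\<close>

text \<open>Bilinear maps are bounded in finite dimension. The resulting constant \<open>K\<close>
  stands in for submultiplicativity of the norm.\<close>

lemma bounded_bilinear_times:
  "bounded_bilinear ((*) :: 'a \<Rightarrow> 'a \<Rightarrow> 'a::{real_algebra_1,euclidean_space})"
  by (rule bilinear_conv_bounded_bilinear[THEN iffD1])
    (simp add: bilinear_def linear_iff algebra_simps)

lemma linear_times_left:
  "linear ((*) (a :: 'a::{real_algebra_1,euclidean_space}))"
  by (simp add: linear_iff algebra_simps)

text \<open>In finite dimension an injective left multiplication is onto, which gives a right
  inverse \<open>b\<close>; then \<open>a * (b * a - 1) = 0\<close> makes it a left inverse
  too.\<close>

lemma inj_times_left_imp_inverse: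
  fixes a :: "'a::{real_algebra_1,euclidean_space}"
  assumes "\<And>y. a * y = 0 \<Longrightarrow> y = 0"
  shows "\<exists>b. a * b = 1 \<and> b * a = 1"
proof -
  have "inj ((*) a)"
    using assms linear_injective_0[OF linear_times_left] by blast
  then have "surj ((*) a)"
    by (rule linear_inj_imp_surj[OF linear_times_left])
  then obtain b where b: "a * b = 1" by (metis surjD)
  have "a * (b * a - 1) = 0" by (simp add: right_diff_distrib b mult.assoc[symmetric])
  then have "b * a - 1 = 0" by (rule assms)
  with b show ?thesis by auto
qed

definition unit_elems :: "'a::{real_algebra_1,euclidean_space} set" where
  "unit_elems = {a. \<exists>b. a * b = 1 \<and> b * a = 1}"

text \<open>Two-sided inverses are unique, so the choice is forced on \<open>unit_elems\<close>;
  elsewhere the value is arbitrary.\<close>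

definition unit_inv :: "'a::{real_algebra_1,euclidean_space} \<Rightarrow> 'a" where
  "unit_inv a = (SOME b. a * b = 1 \<and> b * a = 1)"

lemma unit_inv:
  assumes "a \<in> unit_elems"
  shows unit_inv_right: "a * unit_inv a = 1" and unit_inv_left: "unit_inv a * a = 1"
  using someI_ex[of "\<lambda>b. a * b = 1 \<and> b * a = 1"] assms
  unfolding unit_elems_def unit_inv_def by auto

text \<open>The left inverse of \<open>a\<close> bounds multiplication by \<open>a\<close> from
  below, and a small perturbation costs at most half of the bound. This yields both openness of the
  units and continuity of the inverse.\<close>

lemma unit_elems_lower_bound:
  fixes a :: "'a::{real_algebra_1,euclidean_space}"
  assumes "a \<in> unit_elems"
  obtains e c where "e > 0" "c > 0" "\<And>x y. norm (x - a) < e \<Longrightarrow> norm y \<le> c * norm (x * y)"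
proof -
  obtain K where K: "K > 0" "\<And>x y :: 'a. norm (x * y) \<le> norm x * norm y * K"
    using bounded_bilinear.pos_bounded[OF bounded_bilinear_times] by blast
  define b where "b = unit_inv a"
  have b: "b * a = 1" "b \<noteq> 0"
    using unit_inv[OF assms] by (auto simp: b_def)
  define c where "c = norm b * K"
  have c: "c > 0" using b K by (simp add: c_def)
  \<comment> \<open>Chosen so that \<open>c * e * K = 1 / 2\<close>: the error term is absorbed on
    the left, at the price of doubling \<open>c\<close>.\<close>
  define e where "e = 1 / (2 * c * K)"
  have e: "e > 0" using c K by (simp add: e_def)
  have "norm y \<le> 2 * c * norm (x * y)" if "norm (x - a) < e" for x y
  proof -
    have "norm y = norm (b * (a * y))" using b by (simp add: mult.assoc[symmetric])
    also have "\<dots> \<le> norm b * norm (a * y) * K" by (rule K)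
    finally have 1: "norm y \<le> c * norm (a * y)" by (simp add: c_def mult_ac)
    have "norm (a * y) \<le> norm (x * y) + norm ((x - a) * y)"
      using norm_triangle_ineq4[of "x * y" "(x - a) * y"] by (simp add: algebra_simps)
    also have "norm ((x - a) * y) \<le> norm (x - a) * norm y * K" by (rule K)
    also have "\<dots> \<le> e * norm y * K"
      using that K by (intro mult_right_mono) auto
    finally have "c * norm (a * y) \<le> c * (norm (x * y) + e * norm y * K)"
      using c by simp
    with 1 have "norm y \<le> c * norm (x * y) + c * e * K * norm y"
      by (simp add: algebra_simps)
    moreover have "c * e * K = 1 / 2" using c K by (simp add: e_def)
    ultimately show ?thesis by simp
  qed
  then show ?thesis using that[of e "2 * c"] c e by simp
qed

lemma open_unit_elems: "open (unit_elems :: 'a::{real_algebra_1,euclidean_space} set)"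
  unfolding open_dist
proof
  fix a :: 'a assume "a \<in> unit_elems"
  then obtain e c where e: "e > 0" "\<And>x y. norm (x - a) < e \<Longrightarrow> norm y \<le> c * norm (x * y)"
    using unit_elems_lower_bound by metis
  have "x \<in> unit_elems" if "dist x a < e" for x
  proof -
    have "y = 0" if "x * y = 0" for y
      using e(2)[of x y] that \<open>dist x a < e\<close> by (simp add: dist_norm)
    then show ?thesis
      using inj_times_left_imp_inverse by (auto simp: unit_elems_def)
  qed
  then show "\<exists>e>0. \<forall>x. dist x a < e \<longrightarrow> x \<in> unit_elems"
    using e by blast
qed

lemma isCont_unit_inv:
  fixes a :: "'a::{real_algebra_1,euclidean_space}"
  assumes "a \<in> unit_elems"
  shows "isCont unit_inv a"
proof -
  obtain e c where e: "e > 0" "c > 0" "\<And>x y. norm (x - a) < e \<Longrightarrow> norm y \<le> c * norm (x * y)"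
    using unit_elems_lower_bound[OF assms] by metis
  have "eventually (\<lambda>x. x \<in> unit_elems) (at a)"
    using open_unit_elems assms by (rule eventually_at_in_open')
  moreover have "eventually (\<lambda>x. norm (x - a) < e) (at a)"
    using e(1) unfolding eventually_at by (auto simp: dist_norm)
  ultimately have "eventually (\<lambda>x. norm (unit_inv x - unit_inv a)
      \<le> c * norm ((a - x) * unit_inv a)) (at a)"
  proof eventually_elim
    case (elim x)
    \<comment> \<open>The right side is free of \<open>unit_inv x\<close>, so the lower bound
      applies without a prior bound on the inverses near \<open>a\<close>.\<close>
    have "x * (unit_inv x - unit_inv a) = (a - x) * unit_inv a"
      using unit_inv[OF assms] unit_inv[OF elim(1)] by (simp add: algebra_simps)
    then show ?case using e(3)[OF elim(2), of "unit_inv x - unit_inv a"] by simp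
  qed
  moreover have "((\<lambda>x. c * norm ((a - x) * unit_inv a)) \<longlongrightarrow> c * norm ((a - a) * unit_inv a)) (at a)"
    by (intro tendsto_mult_left tendsto_norm bounded_bilinear.tendsto[OF bounded_bilinear_times]
        tendsto_diff tendsto_const tendsto_ident_at)
  ultimately have "((\<lambda>x. unit_inv x - unit_inv a) \<longlongrightarrow> 0) (at a)"
    by (simp add: Lim_null_comparison)
  then show ?thesis by (simp add: isCont_def LIM_zero_iff)
qed

text \<open>With \<open>b = unit_inv a\<close>, the first-order remainder is exactly
  \<open>(b - unit_inv x) * (x - a) * b\<close>, whose first factor tends to 0 by
  continuity.\<close>

lemma has_derivative_unit_inv:
  fixes a :: "'a::{real_algebra_1,euclidean_space}"
  assumes "a \<in> unit_elems"
  shows "(unit_inv has_derivative (\<lambda>h. - (unit_inv a * h * unit_inv a))) (at a)"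
proof -
  obtain K where K: "K > 0" "\<And>x y :: 'a. norm (x * y) \<le> norm x * norm y * K"
    using bounded_bilinear.pos_bounded[OF bounded_bilinear_times] by blast
  define b where "b = unit_inv a"
  have ev: "eventually (\<lambda>x. x \<in> unit_elems) (at a)"
    using open_unit_elems assms by (rule eventually_at_in_open')
  have "eventually (\<lambda>x. norm ((unit_inv x - b - - (b * (x - a) * b)) /\<^sub>R norm (x - a))
      \<le> norm (unit_inv x - b) * norm b * K * K) (at a)"
    using ev
  proof eventually_elim
    case (elim x)
    have l: "b * a = 1" and r: "a * b = 1" using unit_inv[OF assms] by (auto simp: b_def)
    have l': "unit_inv x * x = 1" using unit_inv[OF elim] by auto
    have "(b - unit_inv x) * (x - a) * b = b * x * b - b * (a * b) - unit_inv x * x * b + unit_inv x * (a * b)"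
      by (simp add: algebra_simps)
    also have "\<dots> = unit_inv x - b - - (b * (x - a) * b)"
      using l by (simp add: l' r algebra_simps)
    finally have eq: "unit_inv x - b - - (b * (x - a) * b) = (b - unit_inv x) * (x - a) * b" by simp
    have "norm ((b - unit_inv x) * (x - a) * b) \<le> norm ((b - unit_inv x) * (x - a)) * norm b * K"
      by (rule K)
    also have "\<dots> \<le> (norm (b - unit_inv x) * norm (x - a) * K) * norm b * K"
      using K by (intro mult_right_mono) auto
    also have "\<dots> = (norm (unit_inv x - b) * norm b * K * K) * norm (x - a)"
      by (simp add: norm_minus_commute)
    finally show ?case unfolding eq
      by (cases "x = a") (use K in \<open>auto simp: divide_simps\<close>)
  qed
  moreover have "((\<lambda>x. norm (unit_inv x - b) * norm b * K * K) \<longlongrightarrow> norm (b - b) * norm b * K * K) (at a)"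
    using isCont_unit_inv[OF assms] unfolding isCont_def b_def
    by (intro tendsto_mult_right tendsto_norm tendsto_diff tendsto_const)
  ultimately have "((\<lambda>x. (unit_inv x - b - - (b * (x - a) * b)) /\<^sub>R norm (x - a)) \<longlongrightarrow> 0) (at a)"
    by (simp add: Lim_null_comparison)
  moreover have "bounded_linear (\<lambda>h. - (b * h * b))"
    by (rule linear_conv_bounded_linear[THEN iffD1]) (simp add: linear_iff algebra_simps)
  ultimately show ?thesis
    by (simp add: has_derivative_def b_def)
qed

text \<open>The derivative is a polynomial expression in the inverse itself, so regularity of order
  \<open>k\<close> bootstraps to order \<open>Suc k\<close>.\<close>

lemma Ck_on_unit_inv:
  fixes p :: "'a::{real_algebra_1,euclidean_space}"
  assumes "open V" "\<And>x. x \<in> V \<Longrightarrow> x + p \<in> unit_elems"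
  shows "Ck_on k V (\<lambda>x. unit_inv (x + p))"
proof (induction k)
  case 0
  have "continuous (at x) (\<lambda>x. unit_inv (x + p))" if "x \<in> V" for x
    using assms(2)[OF that] by (intro continuous_intros isCont_o2[OF _ isCont_unit_inv])
  then show ?case by (simp add: continuous_at_imp_continuous_on)
next
  case (Suc k)
  let ?i = "\<lambda>x. unit_inv (x + p)"
  show ?case
  proof (rule Ck_on_SucI[OF assms(1)])
    show "(?i has_derivative (\<lambda>h. - (?i x * h * ?i x))) (at x)" if "x \<in> V" for x
      by (rule has_derivative_compose[where f = "\<lambda>x. x + p", OF _ has_derivative_unit_inv[OF assms(2)[OF that]]])
        (auto intro!: derivative_eq_intros)
    show "Ck_on k V (\<lambda>x. - (?i x * h * ?i x))" for h
      by (intro Ck_on_linear[OF bounded_linear_minus[OF bounded_linear_ident]] assms(1)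
          Ck_on_bilinear[OF bounded_bilinear_times] Suc Ck_on_const)
  qed
qed

section \<open>The Cayley chart\<close>

lemma imag_units_D: "s \<in> imag_units \<Longrightarrow> s * s = - 1"
  by (simp add: imag_units_def power2_eq_square)

definition cayley :: "'a::{real_algebra_1,euclidean_space} \<Rightarrow> 'a \<Rightarrow> 'a" where
  "cayley p s = unit_inv (s + p) * (s - p)"

lemma Ck_on_cayley:
  assumes "open V" "\<And>x. x \<in> V \<Longrightarrow> x + p \<in> unit_elems"
  shows "Ck_on k V (cayley p)"
proof -
  have "Ck_on k V (\<lambda>x. unit_inv (x + p) * (x + - p))"
    by (intro Ck_on_bilinear[OF bounded_bilinear_times] Ck_on_unit_inv assms
        Ck_on_add Ck_on_id Ck_on_const)
  then show ?thesis by (simp add: cayley_def[abs_def])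
qed

text \<open>The product rule is grouped so that \<open>h\<close> stands directly after the inverse;
  when \<open>h\<close> becomes \<open>s * h\<close>, the factor \<open>s\<close> can move to the
  front as \<open>p\<close>.\<close>

lemma has_derivative_cayley:
  assumes "s + p \<in> unit_elems"
  shows "(cayley p has_derivative (\<lambda>h. unit_inv (s + p) * h * (1 - cayley p s))) (at s)"
proof -
  have "((\<lambda>x. unit_inv (x + p)) has_derivative (\<lambda>h. - (unit_inv (s + p) * h * unit_inv (s + p)))) (at s)"
    by (rule has_derivative_compose[where f = "\<lambda>x. x + p", OF _ has_derivative_unit_inv[OF assms]])
      (auto intro!: derivative_eq_intros)
  moreover have "((\<lambda>x. x - p) has_derivative (\<lambda>h. h)) (at s)"
    by (auto intro!: derivative_eq_intros)
  ultimately have "((\<lambda>x. unit_inv (x + p) * (x - p)) has_derivative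
     (\<lambda>h. unit_inv (s + p) * h + - (unit_inv (s + p) * h * unit_inv (s + p)) * (s - p))) (at s)"
    by (rule bounded_bilinear.FDERIV[OF bounded_bilinear_times])
  then show ?thesis by (simp add: cayley_def[abs_def] algebra_simps)
qed

text \<open>Both squares are -1, so \<open>s * (s + p) = (s + p) * p\<close>. This is what turns
  multiplication by \<open>s\<close> on tangent vectors into multiplication by \<open>p\<close> in
  the chart.\<close>

lemma unit_inv_intertwine:
  assumes s: "s \<in> imag_units" and p: "p \<in> imag_units" and u: "s + p \<in> unit_elems"
  shows "unit_inv (s + p) * s = p * unit_inv (s + p)"
proof -
  have "unit_inv (s + p) * s * ((s + p) * unit_inv (s + p)) =
      unit_inv (s + p) * (s * s + s * p) * unit_inv (s + p)"
    by (simp add: algebra_simps)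
  also have "s * s + s * p = (s + p) * p"
    using imag_units_D[OF s] imag_units_D[OF p] by (simp add: algebra_simps)
  also have "unit_inv (s + p) * ((s + p) * p) * unit_inv (s + p) = p * unit_inv (s + p)"
    by (simp only: mult.assoc[symmetric] unit_inv[OF u] mult_1_left)
  finally show ?thesis by (simp add: unit_inv[OF u])
qed

lemma cayley_anticommute:
  assumes s: "s \<in> imag_units" and p: "p \<in> imag_units" and u: "s + p \<in> unit_elems"
  shows "cayley p s * p = - (p * cayley p s)"
proof -
  have "p * cayley p s = unit_inv (s + p) * s * (s - p)"
    by (simp add: cayley_def unit_inv_intertwine[OF assms] mult.assoc[symmetric])
  also have "\<dots> = unit_inv (s + p) * (s * s - s * p)" by (simp add: algebra_simps)
  also have "s * s - s * p = - ((s - p) * p)"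
    using imag_units_D[OF s] imag_units_D[OF p] by (simp add: algebra_simps)
  finally show ?thesis by (simp add: cayley_def mult.assoc)
qed

lemma one_minus_cayley:
  assumes u: "s + p \<in> unit_elems"
  shows "1 - cayley p s = 2 *\<^sub>R (unit_inv (s + p) * p)"
proof -
  have "1 - cayley p s = unit_inv (s + p) * (s + p) - unit_inv (s + p) * (s - p)"
    by (simp add: cayley_def unit_inv[OF u])
  also have "\<dots> = unit_inv (s + p) * p + unit_inv (s + p) * p"
    by (simp add: algebra_simps)
  finally show ?thesis by (simp add: scaleR_2)
qed

text \<open>The mirror identity \<open>(s + p) * s = p * (s + p)\<close> carries \<open>s\<close>
  through the inverse from the other side.\<close>

lemma one_minus_cayley_intertwine:
  assumes s: "s \<in> imag_units" and p: "p \<in> imag_units" and u: "s + p \<in> unit_elems"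
  shows "s * (1 - cayley p s) = (1 - cayley p s) * p"
proof -
  have "s * unit_inv (s + p) = unit_inv (s + p) * ((s + p) * s) * unit_inv (s + p)"
    by (simp only: mult.assoc[symmetric] unit_inv[OF u] mult_1_left)
  also have "(s + p) * s = p * (s + p)"
    using imag_units_D[OF s] imag_units_D[OF p] by (simp add: algebra_simps)
  also have "unit_inv (s + p) * (p * (s + p)) * unit_inv (s + p) = unit_inv (s + p) * p"
    by (simp only: mult.assoc unit_inv[OF u] mult_1_right)
  finally show ?thesis
    by (simp add: one_minus_cayley[OF u] mult.assoc[symmetric])
qed

lemma one_minus_cayley_surj:
  assumes p: "p \<in> imag_units" and u: "s + p \<in> unit_elems"
  shows "\<exists>y. x = (1 - cayley p s) * y"
proof
  \<comment> \<open>The witness comes from inverting each factor of \<open>1 - cayley p s\<close>,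
    the inverse of \<open>p\<close> being \<open>- p\<close>.\<close>
  have "2 *\<^sub>R (unit_inv (s + p) * p) * ((- 1 / 2) *\<^sub>R (p * (s + p)) * x)
      = - (unit_inv (s + p) * (p * p) * (s + p) * x)"
    by (simp only: mult.assoc mult_scaleR_left mult_scaleR_right) simp
  then show "x = (1 - cayley p s) * ((- 1 / 2) *\<^sub>R (p * (s + p)) * x)"
    by (simp add: one_minus_cayley[OF u] imag_units_D[OF p] unit_inv[OF u])
qed

section \<open>Orthogonal imaginary units\<close>

text \<open>Left multiplication by \<open>s\<close> has inverse \<open>- s\<close>, so the
  orthogonality condition forces its adjoint to be multiplication by \<open>- s\<close>. The
  resulting equations are continuous in \<open>s\<close>.\<close>

lemma orth_imag_units_iff:
  "s \<in> orth_imag_units \<longleftrightarrow> s \<in> imag_units \<and> (\<forall>x y. inner (s * x) y + inner x (s * y) = 0)"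
proof (cases "s \<in> imag_units")
  case True
  have ss: "s * (s * x) = - x" for x
    using imag_units_D[OF True] by (simp add: mult.assoc[symmetric])
  have adj: "inner x (adjoint ((*) s) y) = inner (s * x) y" for x y
    using adjoint_works[OF linear_times_left] by blast
  show ?thesis
  proof
    assume "s \<in> orth_imag_units"
    then have id: "s * adjoint ((*) s) x = x" for x
      unfolding orth_imag_units_def by (auto simp: fun_eq_iff)
    have "adjoint ((*) s) y = - (s * y)" for y
      using ss[of "adjoint ((*) s) y"] id[of y] by (metis minus_minus)
    with adj have "inner (s * x) y = - inner x (s * y)" for x y
      by (metis inner_minus_right)
    then show "s \<in> imag_units \<and> (\<forall>x y. inner (s * x) y + inner x (s * y) = 0)"
      using True by simp
  next
    assume R: "s \<in> imag_units \<and> (\<forall>x y. inner (s * x) y + inner x (s * y) = 0)"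
    have "adjoint ((*) s) = (\<lambda>y. - (s * y))"
    proof (rule adjoint_unique, intro allI)
      show "inner (s * x) y = inner x (- (s * y))" for x y
        using R by (simp add: eq_neg_iff_add_eq_0)
    qed
    then show "s \<in> orth_imag_units"
      using True by (auto simp: orth_imag_units_def ss)
  qed
qed (auto simp: orth_imag_units_def)

section \<open>Compactness of the orthogonal imaginary units\<close>

lemma closed_orth_imag_units:
  "closed (orth_imag_units :: 'a::{real_algebra_1,euclidean_space} set)"
proof -
  have [continuous_intros]: "continuous_on UNIV (\<lambda>s. f s * g s)"
    if "continuous_on UNIV f" "continuous_on UNIV g" for f g :: "'a \<Rightarrow> 'a"
    using bounded_bilinear.continuous_on[OF bounded_bilinear_times that] .
  have "orth_imag_units = {s::'a. s * s = - 1} \<inter>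
      (\<Inter>x. \<Inter>y. {s. inner (s * x) y + inner x (s * y) = 0})"
    by (auto simp: orth_imag_units_iff) (auto simp: imag_units_def power2_eq_square)
  also have "closed \<dots>"
    by (intro closed_Int closed_INT ballI closed_Collect_eq continuous_intros)
  finally show ?thesis .
qed

lemma compact_orth_imag_units:
  "compact (orth_imag_units :: 'a::{real_algebra_1,euclidean_space} set)"
proof -
  have "norm s = norm (1::'a)" if "s \<in> orth_imag_units" for s :: 'a
  proof -
    \<comment> \<open>Skew-adjointness is tested on the pair \<open>1\<close>, \<open>s\<close>;
      with \<open>s * s = - 1\<close> it compares the norms of \<open>s\<close> and
      \<open>1\<close>.\<close>
    have "inner (s * 1) s + inner 1 (s * s) = 0"
      using that unfolding orth_imag_units_iff by blast
    moreover have "s * s = - 1"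
      using that imag_units_D orth_imag_units_iff by blast
    ultimately show ?thesis by (simp add: norm_eq_sqrt_inner)
  qed
  then have "bounded (orth_imag_units :: 'a set)"
    unfolding bounded_iff by (metis order_refl)
  then show ?thesis using closed_orth_imag_units compact_eq_bounded_closed by blast
qed

section \<open>Local equations in the Cayley chart\<close>

text \<open>The bilinear form of the sum of left multiplication by \<open>v\<close> and its
  adjoint.\<close>

definition skew_defect :: "'a::{real_algebra_1,euclidean_space} \<Rightarrow> 'a \<Rightarrow> 'a \<Rightarrow> real" where
  "skew_defect v x y = inner x (v * y) + inner (v * x) y"

text \<open>The complex linear form in \<open>w\<close>, for the complex structure \<open>w \<mapsto> pw\<close>, whose real part is
  the defect of \<open>pw\<close>.\<close>

definition local_eq :: "'a::{real_algebra_1,euclidean_space} \<Rightarrow> 'a \<Rightarrow> 'a \<Rightarrow> 'a \<Rightarrow> complex" where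
  "local_eq p x y w = Complex (skew_defect (p * w) x y) (skew_defect w x y)"

lemma skew_defect_linear:
  "skew_defect (v + w) x y = skew_defect v x y + skew_defect w x y"
  "skew_defect (r *\<^sub>R v) x y = r * skew_defect v x y"
  "skew_defect (- v) x y = - skew_defect v x y"
  by (simp_all add: skew_defect_def algebra_simps)

lemma bounded_linear_local_eq: "bounded_linear (local_eq p x y)"
  by (rule linear_conv_bounded_linear[THEN iffD1])
    (simp add: linear_iff local_eq_def skew_defect_linear ring_distribs complex_eq_iff)

text \<open>Passing from \<open>w\<close> to \<open>p * w\<close> moves the imaginary part to the
  real part with a sign, because \<open>p * (p * w) = - w\<close>.\<close>

lemma local_eq_times:
  assumes "p \<in> imag_units"
  shows "local_eq p x y (p * w) = \<i> * local_eq p x y w"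
proof -
  have "p * (p * w) = - w" using imag_units_D[OF assms] by (simp add: mult.assoc[symmetric])
  then show ?thesis by (simp add: local_eq_def skew_defect_linear complex_eq_iff)
qed

text \<open>By bilinearity finitely many pairs suffice, which makes the family of local equations
  finite.\<close>

lemma skew_defect_Basis:
  assumes "\<And>b c. b \<in> Basis \<Longrightarrow> c \<in> Basis \<Longrightarrow> skew_defect v b c = 0"
  shows "skew_defect v x y = 0"
proof -
  have L1: "linear (\<lambda>x. skew_defect v x y)" for y
    by (simp add: linear_iff skew_defect_def algebra_simps)
  have L2: "linear (skew_defect v x)" for x
    by (simp add: linear_iff skew_defect_def algebra_simps)
  have "skew_defect v b = (\<lambda>_. 0)" if "b \<in> Basis" for b
    by (rule linear_eq_stdbasis[OF L2 linear_zero]) (rule assms[OF that])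
  then have "(\<lambda>x. skew_defect v x y) = (\<lambda>_. 0)"
    by (intro linear_eq_stdbasis[OF L1 linear_zero]) simp
  then show ?thesis by (rule fun_cong)
qed

lemma orth_imag_units_iff_local_eq:
  fixes s p :: "'a::{real_algebra_1,euclidean_space}"
  assumes s: "s \<in> imag_units" and p: "p \<in> orth_imag_units" and u: "s + p \<in> unit_elems"
  shows "s \<in> orth_imag_units \<longleftrightarrow> (\<forall>b\<in>Basis. \<forall>c\<in>Basis. local_eq p b c (cayley p s) = 0)"
proof -
  define w where "w = cayley p s"
  have p': "p \<in> imag_units" and skew: "inner (p * x) y = - inner x (p * y)" for x y
    using p by (auto simp: orth_imag_units_iff eq_neg_iff_add_eq_0)
  have pp: "p * (p * x) = - x" for x
    using imag_units_D[OF p'] by (simp add: mult.assoc[symmetric])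
  have wp: "w * (p * x) = - (p * (w * x))" for x
    using cayley_anticommute[OF s p' u] by (simp add: w_def mult.assoc[symmetric])
  have su: "s * ((1 - w) * x) = (1 - w) * (p * x)" for x
    using one_minus_cayley_intertwine[OF s p' u] by (simp add: w_def mult.assoc[symmetric])
  \<comment> \<open>The four first-order terms coincide in pairs, by anticommutation of
    \<open>w\<close> with \<open>p\<close> and skewness of \<open>p\<close>; hence the factor
    2.\<close>
  have key: "inner (s * ((1 - w) * x)) ((1 - w) * y) + inner ((1 - w) * x) (s * ((1 - w) * y))
      = 2 * skew_defect (p * w) x y" for x y
    unfolding su
    by (simp add: left_diff_distrib inner_diff_left inner_diff_right inner_add_left inner_add_right distrib_left wp skew
        skew_defect_def mult.assoc)
  have 1: "s \<in> orth_imag_units \<longleftrightarrow> (\<forall>x y. skew_defect (p * w) x y = 0)"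
  proof
    assume "s \<in> orth_imag_units"
    then show "\<forall>x y. skew_defect (p * w) x y = 0"
      using key by (auto simp: orth_imag_units_iff)
  next
    assume 0: "\<forall>x y. skew_defect (p * w) x y = 0"
    have "inner (s * x) y + inner x (s * y) = 0" for x y
    proof -
      \<comment> \<open>The identity \<open>key\<close> speaks of pairs in the image of
        \<open>1 - w\<close>; surjectivity makes these all pairs.\<close>
      obtain x' y' where "x = (1 - w) * x'" "y = (1 - w) * y'"
        using one_minus_cayley_surj[OF p' u] unfolding w_def by blast
      then show ?thesis using key 0 by simp
    qed
    then show "s \<in> orth_imag_units" using s by (simp add: orth_imag_units_iff)
  qed
  \<comment> \<open>The imaginary part of \<open>local_eq\<close> is its real part at another pair,
    so the complex equations cut out the same set as the real ones.\<close>
  have "skew_defect w x y = skew_defect (p * w) x (p * y)" for x y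
    by (simp add: skew_defect_def mult.assoc wp skew pp)
  then show ?thesis
    unfolding 1 local_eq_def w_def[symmetric] complex_eq_iff
    using skew_defect_Basis[of "p * w"] by auto
qed

section \<open>Holomorphy of the local equations\<close>

lemma frechet_derivative_local_eq_cayley:
  assumes "s + p \<in> unit_elems"
  shows "frechet_derivative (\<lambda>x. local_eq p b c (cayley p x)) (at s) =
    (\<lambda>h. local_eq p b c (unit_inv (s + p) * h * (1 - cayley p s)))"
  by (rule frechet_derivative_at[symmetric])
    (intro bounded_linear.has_derivative[OF bounded_linear_local_eq] has_derivative_cayley assms)

lemma holomorphic_local_eq_cayley:
  fixes p :: "'a::{real_algebra_1,euclidean_space}"
  assumes p: "p \<in> imag_units" and V: "open V" "\<And>x. x \<in> V \<Longrightarrow> x + p \<in> unit_elems"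
    and W: "W \<subseteq> imag_units \<inter> V"
  shows "holomorphic_on_imag_units W (\<lambda>x. local_eq p b c (cayley p x))" (is "holomorphic_on_imag_units _ ?F")
  unfolding holomorphic_on_imag_units_def
proof
  fix s assume "s \<in> W"
  then have s: "s \<in> imag_units" "s \<in> V" "s + p \<in> unit_elems"
    using W V by auto
  have smooth: "smooth_on V ?F"
    unfolding smooth_on_def
    by (intro allI Ck_on_linear[OF bounded_linear_local_eq V(1)] Ck_on_cayley V)
  \<comment> \<open>The factor \<open>s\<close> from the complex structure leaves the derivative as
    a leading \<open>p\<close>, which \<open>local_eq_times\<close> converts into \<i>.\<close>
  have "unit_inv (s + p) * (s * k) = p * (unit_inv (s + p) * k)" for k
    using unit_inv_intertwine[OF s(1) p s(3)] by (simp add: mult.assoc[symmetric])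
  then have "frechet_derivative ?F (at s) (J_imag_units s h) =
      \<i> * frechet_derivative ?F (at s) h" for h
    by (simp add: frechet_derivative_local_eq_cayley[OF s(3)] J_imag_units_def
        local_eq_times[OF p] mult.assoc)
  with smooth V(1) s(2) show "\<exists>V F. open V \<and> s \<in> V \<and> smooth_on V F \<and>
      (\<forall>x\<in>V \<inter> W. F x = ?F x) \<and>
      (\<forall>h\<in>tangent_imag_units s.
        frechet_derivative F (at s) (J_imag_units s h) = \<i> * frechet_derivative F (at s) h)"
    by (intro exI[of _ V] exI[of _ ?F]) simp
qed

theorem theorem5p3:
  assumes "inner (1 :: 'a::{real_algebra_1,euclidean_space}) 1 = 1"
  shows "compact (orth_imag_units :: 'a set) \<and>
         complex_subvariety_imag_units (orth_imag_units :: 'a set)"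
proof
  show "compact (orth_imag_units :: 'a set)" by (rule compact_orth_imag_units)
  show "complex_subvariety_imag_units (orth_imag_units :: 'a set)"
    unfolding complex_subvariety_imag_units_def
  proof (intro conjI ballI)
    show cl: "closedin (top_of_set imag_units) (orth_imag_units :: 'a set)"
      by (intro closed_subset closed_orth_imag_units) (auto simp: orth_imag_units_def)
    fix p :: 'a assume p: "p \<in> imag_units"
    show "\<exists>W \<F>. openin (top_of_set imag_units) W \<and> p \<in> W \<and>
        finite \<F> \<and> (\<forall>f\<in>\<F>. holomorphic_on_imag_units W f) \<and>
        orth_imag_units \<inter> W = {x \<in> W. \<forall>f\<in>\<F>. f x = 0}"
    proof (cases "p \<in> orth_imag_units")
      case False
      have "openin (top_of_set imag_units) (imag_units - orth_imag_units :: 'a set)"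
        using cl by (auto simp: closedin_def)
      moreover have "holomorphic_on_imag_units W (\<lambda>_. 1)" for W :: "'a set"
        unfolding holomorphic_on_imag_units_def smooth_on_def
        by (intro ballI exI[of _ UNIV] exI[of _ "\<lambda>_. 1"]) (simp add: Ck_on_const)
      ultimately show ?thesis
        using p False
        by (intro exI[of _ "imag_units - orth_imag_units"] exI[of _ "{\<lambda>_. 1}"]) auto
    next
      case True
      define V where "V = {x. x + p \<in> unit_elems}"
      \<comment> \<open>The domain of the chart centred at \<open>p\<close>.\<close>
      define W where "W = imag_units \<inter> V"
      define \<F> where "\<F> = (\<lambda>(b, c). \<lambda>x. local_eq p b c (cayley p x)) ` (Basis \<times> Basis)"
      have V: "open V"
        unfolding V_def using open_vimage[OF open_unit_elems, of "\<lambda>x. x + p"]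
        by (simp add: vimage_def continuous_on_add)
      \<comment> \<open>The centre lies in its own chart domain: \<open>p * p = - 1\<close> gives
        \<open>p + p\<close> the inverse \<open>(- 1 / 2) *\<^sub>R p\<close>.\<close>
      have "p + p \<in> unit_elems"
        unfolding unit_elems_def
        by (rule CollectI, rule exI[of _ "(- 1 / 2) *\<^sub>R p"])
          (simp add: imag_units_D[OF p] flip: scaleR_2)
      then have "p \<in> W" using p by (simp add: W_def V_def)
      moreover have "openin (top_of_set imag_units) W"
        using V by (auto simp: W_def openin_open)
      moreover have "holomorphic_on_imag_units W (\<lambda>x. local_eq p b c (cayley p x))" for b c
        using V by (intro holomorphic_local_eq_cayley[OF p, of V]) (auto simp: W_def V_def)
      moreover have "orth_imag_units \<inter> W = {x \<in> W. \<forall>f\<in>\<F>. f x = 0}"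
        using orth_imag_units_iff_local_eq[OF _ True] by (auto simp: W_def V_def \<F>_def)
      ultimately show ?thesis
        by (intro exI[of _ W] exI[of _ \<F>]) (auto simp: \<F>_def)
    qed
  qed
qed

end
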